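(* Let $n,p\ge 1$, let $A\in GL_n(\mathbb{C})$, and let $Q(X)=X^p-c_{p-1}X^{p-1}-\ldots-c_1X-c_0\in\mathbb{C}[X]$ with $c_0\neq 0$ be such that $Q(A)=0$. Let $c=(c_{p-1},\ldots,c_1,c_0)^t\in\mathbb{C}^p$, let $C_Q\in GL_p(\mathbb{C})$ be the companion matrix of $Q$, and for $1\le i\le p$ and $z\in\mathbb{C}$ let $\mu_i(z):=(C_Q^z c)_i$ be the $i$-th coordinate of $C_Q^z c$. Then for all $z\in\mathbb{C}$ $$A^z=\sum_{i=1}^p \mu_i(z)A^{-i}.$$
   Context: Complex powers of matrices. For every $\lambda\in\mathbb{C}^*$ a value $\log(\lambda)$ with $e^{\log(\lambda)}=\lambda$ is fixed once and for all (the same choice is used for all matrices), and $\lambda^z:=e^{z\log(\lambda)}$. Put $g_0(z)=1$ and $g_i(z)=\frac{1}{i!}z(z-1)\cdots(z-i+1)$ for $i\ge 1$. Let $N_k$ be the $k\times k$ matrix with entries $1$ directly above the diagonal and $0$ elsewhere. For a Jordan block $B=\lambda I_k+N_k$ with $\lambda\ne 0$, define $B^z:=\sum_{i=0}^{k} g_i(z)\lambda^{z-i}N_k^i$. For an invertible matrix $J$ in Jordan normal form, $J^z$ is the block diagonal matrix obtained by replacing each block $B$ by $B^z$. For an invertible matrix $A$ with $M^{-1}AM=J$ in Jordan normal form, $A^z:=MJ^zM^{-1}$ (this does not depend on the choices of $M$ and $J$). Companion matrix. For $Q(X)=X^p-c_{p-1}X^{p-1}-\ldots-c_1X-c_0$,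 $C_Q$ is the $p\times p$ matrix whose first column is $(c_{p-1},c_{p-2},\ldots,c_1,c_0)^t$, whose entries directly above the diagonal are $1$, and whose remaining entries are $0$: $$C_Q=\begin{pmatrix} c_{p-1}&1&0&\cdots&0\\ c_{p-2}&0&1&\cdots&0\\ \vdots&\vdots&\vdots&\ddots&\vdots\\ c_1&0&0&\cdots&1\\ c_0&0&0&\cdots&0\end{pmatrix}.$$ *)

theory Defs
  imports
    Complex_Main
    "Jordan_Normal_Form.Gauss_Jordan_Elimination"
    "Jordan_Normal_Form.Jordan_Normal_Form_Existence"
begin

text \<open>
  Throughout, \<open>L\<close> is the chosen branch of the logarithm on the nonzero complex numbers; only
  its values there matter, and no continuity is assumed.
\<close>

definition log_choice :: "(complex \<Rightarrow> complex) \<Rightarrow> bool" where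
  "log_choice L \<longleftrightarrow> (\<forall>x. x \<noteq> 0 \<longrightarrow> exp (L x) = x)"

definition cpow :: "(complex \<Rightarrow> complex) \<Rightarrow> complex \<Rightarrow> complex \<Rightarrow> complex" where
  "cpow L x z = exp (z * L x)"

text \<open>
  Here \<open>z gchoose i\<close> is $z(z-1)\cdots(z-i+1)/i!$, and \<open>jordan_block k 0\<close> is the
  nilpotent matrix with ones directly above the diagonal.
\<close>

definition jordan_block_cpow ::
    "(complex \<Rightarrow> complex) \<Rightarrow> nat \<Rightarrow> complex \<Rightarrow> complex \<Rightarrow> complex mat" where
  "jordan_block_cpow L k x z =
     (\<Oplus>\<^bsub>module_mat TYPE(complex) k k\<^esub> i\<in>{0..k}.
        ((z gchoose i) * cpow L x (z - of_nat i)) \<cdot>\<^sub>m (jordan_block k 0 ^\<^sub>m i))"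

definition jordan_matrix_cpow ::
    "(complex \<Rightarrow> complex) \<Rightarrow> (nat \<times> complex) list \<Rightarrow> complex \<Rightarrow> complex mat" where
  "jordan_matrix_cpow L n_as z =
     diag_block_mat (map (\<lambda>(k, x). jordan_block_cpow L k x z) n_as)"

text \<open>
  The value does not depend on the Jordan decomposition \<open>A = M * J * M'\<close> with
  \<open>M'\<close> inverse to \<open>M\<close>, so it is singled out by a definite description. It is only
  meaningful for invertible \<open>A\<close>.
\<close>

definition mat_cpow :: "(complex \<Rightarrow> complex) \<Rightarrow> complex mat \<Rightarrow> complex \<Rightarrow> complex mat" where
  "mat_cpow L A z =
     (THE B. \<exists>n_as M M'. 0 \<notin> fst ` set n_as \<and>
        similar_mat_wit A (jordan_matrix n_as) M M' \<and>
        B = M * jordan_matrix_cpow L n_as z * M')"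

definition poly_mat_eval :: "complex poly \<Rightarrow> complex mat \<Rightarrow> complex mat" where
  "poly_mat_eval q A =
     (\<Oplus>\<^bsub>module_mat TYPE(complex) (dim_row A) (dim_row A)\<^esub> i\<in>{0..degree q}.
        coeff q i \<cdot>\<^sub>m (A ^\<^sub>m i))"

text \<open>
  A monic polynomial \<open>X^p - c (p-1) X^(p-1) - ... - c 0\<close> is given by \<open>p\<close> and the
  values \<open>c i\<close> for \<open>i < p\<close>. Vectors and matrices are indexed from 0, so coordinate
  \<open>i\<close> of the coefficient vector is \<open>c (p - 1 - i)\<close>.
\<close>

definition monic_poly :: "nat \<Rightarrow> (nat \<Rightarrow> complex) \<Rightarrow> complex poly" where
  "monic_poly p c = monom 1 p - (\<Sum>i<p. monom (c i) i)"

definition coeff_vec :: "nat \<Rightarrow> (nat \<Rightarrow> complex) \<Rightarrow> complex vec" where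
  "coeff_vec p c = vec p (\<lambda>i. c (p - 1 - i))"

definition companion_mat :: "nat \<Rightarrow> (nat \<Rightarrow> complex) \<Rightarrow> complex mat" where
  "companion_mat p c =
     mat p p (\<lambda>(i, j). if j = 0 then c (p - 1 - i) else if j = Suc i then 1 else 0)"

text \<open>The index \<open>i\<close> below runs over \<open>1, ..., p\<close>.\<close>

definition companion_coord ::
    "(complex \<Rightarrow> complex) \<Rightarrow> nat \<Rightarrow> (nat \<Rightarrow> complex) \<Rightarrow> nat \<Rightarrow> complex \<Rightarrow> complex" where
  "companion_coord L p c i z =
     (mat_cpow L (companion_mat p c) z *\<^sub>v coeff_vec p c) $ (i - 1)"

end

theory Submission
  imports Defs "HOL-Computational_Algebra.Field_as_Ring"
begin

text \<open>
  For a fixed exponent \<open>z\<close> the powers \<open>A^z\<close> and \<open>C^z\<close>, with \<open>C\<close> the companion matrix, are the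
  values \<open>f(A)\<close> and \<open>f(C)\<close> of one and the same polynomial \<open>f\<close>. On a Jordan block
  \<open>x I + N\<close> of size \<open>k\<close> the value of \<open>f\<close> is determined by \<open>f\<close> modulo \<open>(X - x)^k\<close>, and the
  complex power of the block is obtained by putting \<open>N\<close> for \<open>X - x\<close> in a truncated binomial
  series. So \<open>f\<close> only has to agree with finitely many prescribed truncated series, one around
  each eigenvalue of \<open>A\<close> or \<open>C\<close>; by the Chinese remainder theorem such an \<open>f\<close> exists
  (\<open>cpow_polynomial_exists\<close>). The same interpolation, applied to two Jordan forms of one matrix,
  shows that the power does not depend on the Jordan decomposition (\<open>mat_cpow_eq\<close>), and
  \<open>mat_cpow_common_polynomial\<close> gives the common \<open>f\<close>.

  It remains to prove the identity for polynomials. Consider the linear map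
  \<open>\<phi>(v) = v_1 A^(-1) + \<dots> + v_p A^(-p)\<close> from vectors to matrices. Multiplying \<open>Q(A) = 0\<close> by
  \<open>A^(-p)\<close> gives \<open>\<phi>(c) = I\<close>, and the shape of the companion matrix then gives
  \<open>\<phi>(C v) = A \<phi>(v)\<close>: multiplication by \<open>A\<close> shifts the exponents, and the term \<open>v_1 I\<close> that
  falls out is \<open>v_1 \<phi>(c)\<close>. Thus \<open>\<phi>\<close> turns the action of \<open>C\<close> into multiplication by \<open>A\<close>, and
  \<open>\<phi>(f(C) c) = f(A) \<phi>(c) = f(A)\<close> for every polynomial \<open>f\<close>
  (\<open>inverse_power_sum_poly_companion\<close>). With the common \<open>f\<close> from before this reads
  \<open>\<phi>(C^z c) = A^z\<close>.
\<close>

section \<open>Sums of matrices\<close>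

lemma finsum_mat_closed:
  fixes f :: "'b \<Rightarrow> 'a :: comm_ring_1 mat"
  assumes "\<And>k. k \<in> F \<Longrightarrow> f k \<in> carrier_mat nr nc"
  shows "finsum (module_mat TYPE('a) nr nc) f F \<in> carrier_mat nr nc"
proof -
  interpret abelian_group "module_mat TYPE('a) nr nc" by (rule abelian_group_mat)
  show ?thesis using finsum_closed[of f F] assms by (auto simp: module_mat_simps)
qed

lemma index_finsum_mat:
  fixes f :: "'b \<Rightarrow> 'a :: comm_ring_1 mat"
  assumes "finite F" and "\<And>k. k \<in> F \<Longrightarrow> f k \<in> carrier_mat nr nc" and "i < nr" and "j < nc"
  shows "finsum (module_mat TYPE('a) nr nc) f F $$ (i, j) = (\<Sum>k\<in>F. f k $$ (i, j))"
  using assms(1,2)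
proof (induction F)
  case empty
  interpret abelian_group "module_mat TYPE('a) nr nc" by (rule abelian_group_mat)
  show ?case using assms(3,4) by (simp add: module_mat_simps)
next
  case (insert k F)
  interpret abelian_group "module_mat TYPE('a) nr nc" by (rule abelian_group_mat)
  have "f \<in> F \<rightarrow> carrier_mat nr nc" using insert.prems by auto
  moreover have "f k \<in> carrier_mat nr nc" using insert.prems by auto
  moreover have "finsum (module_mat TYPE('a) nr nc) f F \<in> carrier_mat nr nc"
    using insert.prems by (intro finsum_mat_closed) auto
  ultimately show ?case using insert assms(3,4)
    by (simp add: finsum_insert module_mat_simps)
qed

lemma index_mult_mat_sum:
  assumes "A \<in> carrier_mat nr m" "B \<in> carrier_mat m nc" "i < nr" "j < nc"
  shows "(A * B) $$ (i, j) = (\<Sum>l<m. A $$ (i, l) * B $$ (l, j))"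
  using assms by (simp add: scalar_prod_def atLeast0LessThan)

section \<open>Evaluating polynomials at matrices\<close>

lemma pow_mat_Suc_left:
  fixes A :: "'a :: semiring_1 mat"
  assumes A: "A \<in> carrier_mat n n"
  shows "A ^\<^sub>m Suc k = A * A ^\<^sub>m k"
proof (induction k)
  case 0
  show ?case using A by simp
next
  case (Suc k)
  have "A ^\<^sub>m Suc (Suc k) = A * A ^\<^sub>m k * A" using Suc by simp
  also have "\<dots> = A * (A ^\<^sub>m k * A)" using A by (intro assoc_mult_mat[of _ n n _ n _ n]) simp_all
  finally show ?case by simp
qed

lemma poly_mat_eval_carrier [simp]:
  "A \<in> carrier_mat n n \<Longrightarrow> poly_mat_eval f A \<in> carrier_mat n n"
  unfolding poly_mat_eval_def by (auto intro!: finsum_mat_closed pow_carrier_mat)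

lemma poly_mat_eval_dim [simp]:
  assumes "A \<in> carrier_mat n n"
  shows "dim_row (poly_mat_eval f A) = n" "dim_col (poly_mat_eval f A) = n"
  using poly_mat_eval_carrier[OF assms, of f] by auto

lemma index_poly_mat_eval:
  assumes A: "A \<in> carrier_mat n n" and "i < n" "j < n" and N: "degree f \<le> N"
  shows "poly_mat_eval f A $$ (i, j) = (\<Sum>k\<le>N. coeff f k * (A ^\<^sub>m k) $$ (i, j))"
proof -
  have c: "A ^\<^sub>m k \<in> carrier_mat n n" for k using A by simp
  have d: "dim_row A = n" using A by auto
  have "poly_mat_eval f A $$ (i, j) = (\<Sum>k\<in>{0..degree f}. (coeff f k \<cdot>\<^sub>m A ^\<^sub>m k) $$ (i, j))"
    unfolding poly_mat_eval_def d by (rule index_finsum_mat) (simp_all add: c assms(2,3))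
  also have "\<dots> = (\<Sum>k\<in>{0..degree f}. coeff f k * (A ^\<^sub>m k) $$ (i, j))"
    using A assms(2,3) by (intro sum.cong refl index_smult_mat(1)) simp_all
  also have "\<dots> = (\<Sum>k\<le>N. coeff f k * (A ^\<^sub>m k) $$ (i, j))"
    using N by (intro sum.mono_neutral_left) (auto simp: coeff_eq_0)
  finally show ?thesis .
qed

lemma poly_mat_eval_0 [simp]: "A \<in> carrier_mat n n \<Longrightarrow> poly_mat_eval 0 A = 0\<^sub>m n n"
  by (rule eq_matI) (auto simp: index_poly_mat_eval[where N = 0])

lemma poly_mat_eval_add:
  assumes A: "A \<in> carrier_mat n n"
  shows "poly_mat_eval (f + g) A = poly_mat_eval f A + poly_mat_eval g A"
proof (rule eq_matI)
  let ?N = "max (degree f) (degree g)"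
  fix i j assume "i < dim_row (poly_mat_eval f A + poly_mat_eval g A)"
    and "j < dim_col (poly_mat_eval f A + poly_mat_eval g A)"
  then have ij: "i < n" "j < n" using A by auto
  show "poly_mat_eval (f + g) A $$ (i, j) = (poly_mat_eval f A + poly_mat_eval g A) $$ (i, j)"
    using ij A
    by (simp add: index_poly_mat_eval[OF A ij, where N = ?N] degree_add_le sum.distrib
        ring_distribs)
qed (use A in auto)

lemma poly_mat_eval_smult:
  assumes A: "A \<in> carrier_mat n n"
  shows "poly_mat_eval (Polynomial.smult a f) A = a \<cdot>\<^sub>m poly_mat_eval f A"
proof (rule eq_matI)
  fix i j assume "i < dim_row (a \<cdot>\<^sub>m poly_mat_eval f A)" "j < dim_col (a \<cdot>\<^sub>m poly_mat_eval f A)"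
  then have ij: "i < n" "j < n" using A by auto
  show "poly_mat_eval (Polynomial.smult a f) A $$ (i, j) = (a \<cdot>\<^sub>m poly_mat_eval f A) $$ (i, j)"
    using ij A
    by (simp add: index_poly_mat_eval[OF A ij, where N = "degree f"] degree_smult_le
        sum_distrib_left mult.assoc)
qed (use A in auto)

text \<open>
  Horner's rule. Compatibility of evaluation with products, similarity and block structure, and
  later with companion matrices, is proved by induction on the polynomial with this as the step.
\<close>

lemma poly_mat_eval_pCons:
  assumes A: "A \<in> carrier_mat n n"
  shows "poly_mat_eval (pCons a f) A = a \<cdot>\<^sub>m 1\<^sub>m n + A * poly_mat_eval f A"
proof (rule eq_matI)
  fix i j assume "i < dim_row (a \<cdot>\<^sub>m 1\<^sub>m n + A * poly_mat_eval f A)"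
    and "j < dim_col (a \<cdot>\<^sub>m 1\<^sub>m n + A * poly_mat_eval f A)"
  then have ij: "i < n" "j < n" using A by auto
  have pc: "A ^\<^sub>m k \<in> carrier_mat n n" for k using A by simp
  have step: "(A ^\<^sub>m Suc k) $$ (i, j) = (\<Sum>l<n. A $$ (i, l) * (A ^\<^sub>m k) $$ (l, j))" for k
    unfolding pow_mat_Suc_left[OF A] by (rule index_mult_mat_sum[OF A pc ij])
  have "poly_mat_eval (pCons a f) A $$ (i, j) =
      (\<Sum>k\<le>Suc (degree f). coeff (pCons a f) k * (A ^\<^sub>m k) $$ (i, j))"
    by (rule index_poly_mat_eval[OF A ij]) (simp add: degree_pCons_le)
  also have "\<dots> = a * (1\<^sub>m n) $$ (i, j) + (\<Sum>k\<le>degree f. coeff f k * (A ^\<^sub>m Suc k) $$ (i, j))"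
    using A by (subst sum.atMost_Suc_shift) simp
  also have "(\<Sum>k\<le>degree f. coeff f k * (A ^\<^sub>m Suc k) $$ (i, j)) =
      (\<Sum>l<n. A $$ (i, l) * (\<Sum>k\<le>degree f. coeff f k * (A ^\<^sub>m k) $$ (l, j)))"
    unfolding step sum_distrib_left by (subst sum.swap) (simp add: mult.left_commute)
  also have "\<dots> = (\<Sum>l<n. A $$ (i, l) * poly_mat_eval f A $$ (l, j))"
    using ij by (intro sum.cong) (auto simp: index_poly_mat_eval[OF A, where N = "degree f"])
  also have "\<dots> = (A * poly_mat_eval f A) $$ (i, j)"
    by (rule index_mult_mat_sum[OF A poly_mat_eval_carrier[OF A] ij, symmetric])
  finally show "poly_mat_eval (pCons a f) A $$ (i, j) =
      (a \<cdot>\<^sub>m 1\<^sub>m n + A * poly_mat_eval f A) $$ (i, j)"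
    using ij A by simp
qed (use A in auto)

lemma poly_mat_eval_mult:
  assumes A: "A \<in> carrier_mat n n"
  shows "poly_mat_eval (f * g) A = poly_mat_eval f A * poly_mat_eval g A"
proof (induction f)
  case 0
  then show ?case using A poly_mat_eval_carrier[OF A, of g] by simp
next
  case (pCons a f)
  let ?F = "poly_mat_eval f A" and ?G = "poly_mat_eval g A"
  have c: "?F \<in> carrier_mat n n" "?G \<in> carrier_mat n n" using A by auto
  have "poly_mat_eval (pCons a f * g) A = a \<cdot>\<^sub>m ?G + (0 \<cdot>\<^sub>m 1\<^sub>m n + A * (?F * ?G))"
    by (simp add: poly_mat_eval_add[OF A] poly_mat_eval_smult[OF A] poly_mat_eval_pCons[OF A]
        pCons.IH)
  also have "0 \<cdot>\<^sub>m 1\<^sub>m n + A * (?F * ?G) = A * (?F * ?G)"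
    using A c by (intro eq_matI) auto
  also have "A * (?F * ?G) = (A * ?F) * ?G"
    by (rule assoc_mult_mat[symmetric, of _ n n _ n _ n]) (simp_all add: A c)
  also have "a \<cdot>\<^sub>m ?G = (a \<cdot>\<^sub>m 1\<^sub>m n) * ?G"
    using mult_smult_assoc_mat[of "1\<^sub>m n" n n ?G n a] c(2)
    by (simp del: poly_mat_eval_carrier)
  also have "(a \<cdot>\<^sub>m 1\<^sub>m n) * ?G + (A * ?F) * ?G = (a \<cdot>\<^sub>m 1\<^sub>m n + A * ?F) * ?G"
    using A c by (intro add_mult_distrib_mat[symmetric]) auto
  finally show ?case by (simp add: poly_mat_eval_pCons[OF A])
qed

lemma poly_mat_eval_power:
  assumes A: "A \<in> carrier_mat n n"
  shows "poly_mat_eval (f ^ k) A = poly_mat_eval f A ^\<^sub>m k"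
proof (induction k)
  case 0
  have "1 \<cdot>\<^sub>m 1\<^sub>m n = (1\<^sub>m n :: complex mat)" by (rule eq_matI) auto
  then have "poly_mat_eval 1 A = 1\<^sub>m n"
    using A unfolding one_pCons by (simp add: poly_mat_eval_pCons[OF A])
  then show ?case using A by simp
next
  case (Suc k)
  have "poly_mat_eval (f ^ Suc k) A = poly_mat_eval (f ^ k * f) A" by (simp add: mult.commute)
  then show ?case by (simp add: poly_mat_eval_mult[OF A] Suc)
qed

lemma index_poly_mat_eval_sum:
  assumes A: "A \<in> carrier_mat n n" and "i < n" "j < n"
  shows "poly_mat_eval (\<Sum>k\<in>F. f k) A $$ (i, j) = (\<Sum>k\<in>F. poly_mat_eval (f k) A $$ (i, j))"
  using assms by (induction F rule: infinite_finite_induct) (auto simp: poly_mat_eval_add[OF A])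

lemma poly_mat_eval_similar:
  assumes A: "A \<in> carrier_mat n n" and sim: "similar_mat_wit A J M M'"
  shows "poly_mat_eval f A = M * poly_mat_eval f J * M'"
proof (induction f)
  note w = similar_mat_witD2[OF A sim]
  case 0
  then show ?case using w by simp
next
  note w = similar_mat_witD2[OF A sim]
  case (pCons a f)
  let ?F = "poly_mat_eval f J"
  have F: "?F \<in> carrier_mat n n" using w by simp
  have "A * (M * ?F * M') = M * (J * ?F) * M'"
  proof -
    note assoc = assoc_mult_mat[of _ n n _ n _ n]
    have "M' * (M * ?F * M') = (M' * M) * (?F * M')"
      using w(5-7) F by (simp add: assoc del: poly_mat_eval_carrier)
    also have "\<dots> = ?F * M'" using w(5-7) F by (simp add: w(2))
    finally have "M * J * (M' * (M * ?F * M')) = M * (J * ?F) * M'"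
      using w(5-7) F by (simp add: assoc del: poly_mat_eval_carrier)
    moreover have "M * J * M' * (M * ?F * M') = M * J * (M' * (M * ?F * M'))"
      by (rule assoc) (use w(5-7) F in \<open>simp_all del: poly_mat_eval_carrier\<close>)
    ultimately show ?thesis using w(3) by simp
  qed
  moreover have "a \<cdot>\<^sub>m 1\<^sub>m n = M * (a \<cdot>\<^sub>m 1\<^sub>m n) * M'"
  proof -
    have "M * (a \<cdot>\<^sub>m 1\<^sub>m n) * M' = a \<cdot>\<^sub>m (M * M')" using w
      by (simp add: mult_smult_distrib[of _ n n _ n] mult_smult_assoc_mat[of _ n n _ n])
    then show ?thesis by (simp add: w(1))
  qed
  moreover have "M * (a \<cdot>\<^sub>m 1\<^sub>m n) * M' + M * (J * ?F) * M' = M * (a \<cdot>\<^sub>m 1\<^sub>m n + J * ?F) * M'"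
    using w F by (simp add: add_mult_distrib_mat[of _ n n] mult_add_distrib_mat[of _ n n _ n])
  ultimately show ?case
    using pCons.IH by (simp add: poly_mat_eval_pCons[OF A] poly_mat_eval_pCons[OF w(5)])
qed

lemma poly_mat_eval_block_diagonal:
  assumes A: "A \<in> carrier_mat m m" and D: "D \<in> carrier_mat n n"
  shows "poly_mat_eval f (four_block_mat A (0\<^sub>m m n) (0\<^sub>m n m) D) =
    four_block_mat (poly_mat_eval f A) (0\<^sub>m m n) (0\<^sub>m n m) (poly_mat_eval f D)"
proof (induction f)
  note B = four_block_carrier_mat[OF A D]
  case 0
  show ?case by (simp add: poly_mat_eval_0[OF A] poly_mat_eval_0[OF D] poly_mat_eval_0[OF B])
next
  note B = four_block_carrier_mat[OF A D]
  case (pCons a f)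
  have F: "poly_mat_eval f A \<in> carrier_mat m m" "poly_mat_eval f D \<in> carrier_mat n n"
    using A D by auto
  have "a \<cdot>\<^sub>m 1\<^sub>m (m + n) = four_block_mat (a \<cdot>\<^sub>m 1\<^sub>m m) (0\<^sub>m m n) (0\<^sub>m n m) (a \<cdot>\<^sub>m 1\<^sub>m n)"
    by (rule eq_matI) auto
  moreover have "four_block_mat A (0\<^sub>m m n) (0\<^sub>m n m) D *
      four_block_mat (poly_mat_eval f A) (0\<^sub>m m n) (0\<^sub>m n m) (poly_mat_eval f D) =
      four_block_mat (A * poly_mat_eval f A) (0\<^sub>m m n) (0\<^sub>m n m) (D * poly_mat_eval f D)"
    using A D F by (subst mult_four_block_mat[of _ m m _ n _ n _ _ m _ n]) auto
  ultimately show ?case using A D F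
    by (simp add: poly_mat_eval_pCons[OF A] poly_mat_eval_pCons[OF D] poly_mat_eval_pCons[OF B]
        pCons.IH add_four_block_mat[of _ m m _ n _ n])
qed

lemma poly_mat_eval_diag_block_mat:
  assumes "\<And>A. A \<in> set As \<Longrightarrow> square_mat A"
  shows "poly_mat_eval f (diag_block_mat As) = diag_block_mat (map (poly_mat_eval f) As)"
  using assms
proof (induction As)
  case Nil
  show ?case using poly_mat_eval_carrier[of "0\<^sub>m 0 0" 0 f] by auto
next
  case (Cons A As)
  let ?D = "diag_block_mat As"
  have A: "A \<in> carrier_mat (dim_row A) (dim_row A)" using Cons.prems by auto
  have D: "?D \<in> carrier_mat (dim_row ?D) (dim_row ?D)"
    using diag_block_mat_square[of As] Cons.prems by auto
  have dims: "dim_col A = dim_row A" "dim_col ?D = dim_row ?D" using A D by (blast dest: carrier_matD)+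
  have IH: "diag_block_mat (map (poly_mat_eval f) As) = poly_mat_eval f ?D"
    by (rule Cons.IH[symmetric]) (simp add: Cons.prems del: square_mat.simps)
  show ?case
    unfolding list.map diag_block_mat.simps Let_def IH poly_mat_eval_dim[OF A]
      poly_mat_eval_dim[OF D] dims
    by (rule poly_mat_eval_block_diagonal[OF A D])
qed

section \<open>Complex powers as polynomials in the matrix\<close>

lemma coprime_linear_powers:
  fixes x y :: "'a :: field_gcd"
  assumes "x \<noteq> y"
  shows "coprime ([:- x, 1:] ^ m) ([:- y, 1:] ^ m)"
proof -
  have "coprime [:- x, 1:] [:- y, 1:]"
  proof (rule coprimeI)
    fix d assume "d dvd [:- x, 1:]" "d dvd [:- y, 1:]"
    then have "d dvd [:- x, 1:] - [:- y, 1:]" by (rule dvd_diff)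
    then have "d dvd [:y - x:]" by simp
    moreover have "is_unit [:y - x:]"
      using assms by (simp add: is_unit_pCons_iff dvd_field_iff)
    ultimately show "is_unit d" by (rule dvd_trans)
  qed
  then show ?thesis by simp
qed

text \<open>
  The Chinese remainder theorem for the pairwise coprime moduli \<open>(X - x)^m\<close>. Prescribing residues
  here is Hermite interpolation with the Taylor coefficients as data, but it is phrased by
  divisibility, so that neither derivatives nor Taylor expansions of \<open>f\<close> are involved.
\<close>

lemma simultaneous_congruences_linear_powers:
  fixes t :: "'a :: field_gcd \<Rightarrow> 'a poly"
  assumes "finite S"
  shows "\<exists>f. \<forall>x\<in>S. [:- x, 1:] ^ m dvd f - t x"
  using assms
proof (induction S)
  case empty
  show ?case by simp
next
  case (insert y S)
  then obtain f where f: "\<And>x. x \<in> S \<Longrightarrow> [:- x, 1:] ^ m dvd f - t x" by auto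
  define g where "g = (\<Prod>x\<in>S. [:- x, 1:] ^ m)"
  have "coprime g ([:- y, 1:] ^ m)"
    unfolding g_def using insert.hyps by (intro prod_coprime_left coprime_linear_powers) auto
  then obtain u v where uv: "u * g + v * [:- y, 1:] ^ m = 1"
    using bezout_coefficients_fst_snd[of g "[:- y, 1:] ^ m"] that
    by (simp add: coprime_iff_gcd_eq_1)
  \<comment> \<open>By the Bezout identity, \<open>u * g\<close> is 0 modulo the old moduli and 1 modulo the new one.\<close>
  let ?f = "f + (t y - f) * (u * g)"
  have "[:- x, 1:] ^ m dvd ?f - t x" if "x \<in> S" for x
  proof -
    have "[:- x, 1:] ^ m dvd g" unfolding g_def using insert.hyps that by (intro dvd_prodI) auto
    then have "[:- x, 1:] ^ m dvd (f - t x) + (t y - f) * (u * g)" using f[OF that]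
      by (intro dvd_add) auto
    then show ?thesis by (simp add: algebra_simps)
  qed
  moreover have "[:- y, 1:] ^ m dvd ?f - t y"
  proof -
    have "?f - t y = (f - t y) * (1 - u * g)" by (simp add: algebra_simps)
    also have "1 - u * g = v * [:- y, 1:] ^ m" using uv by (simp add: algebra_simps)
    finally show ?thesis by simp
  qed
  ultimately show ?case by (intro exI[of _ ?f]) auto
qed

text \<open>
  At the Jordan block \<open>x I + N\<close> the polynomial \<open>X - x\<close> takes the value \<open>N\<close>, and \<open>N^m = 0\<close>, so
  only the residue of \<open>f\<close> modulo \<open>(X - x)^m\<close> matters there. The residue is taken with a bound \<open>m\<close>
  that may exceed the block size \<open>k\<close>, since several blocks of different sizes can share the
  eigenvalue \<open>x\<close>.
\<close>

lemma jordan_block_cpow_eq_poly_mat_eval: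
  assumes "k \<le> m"
    and dvd: "[:- x, 1:] ^ m dvd
      f - (\<Sum>i<m. Polynomial.smult ((z gchoose i) * cpow L x (z - of_nat i)) ([:- x, 1:] ^ i))"
      (is "_ dvd f - ?t")
  shows "jordan_block_cpow L k x z = poly_mat_eval f (jordan_block k x)"
proof -
  let ?J = "jordan_block k x" and ?N = "jordan_block k (0 :: complex)"
  let ?a = "\<lambda>i. (z gchoose i) * cpow L x (z - of_nat i)"
  have J: "?J \<in> carrier_mat k k" by simp
  have lin: "poly_mat_eval [:- x, 1:] ?J = ?N"
    by (rule eq_matI) (auto simp: poly_mat_eval_pCons[OF J] poly_mat_eval_0[OF J])
  have nil: "?N ^\<^sub>m i = 0\<^sub>m k k" if "k \<le> i" for i
    unfolding jordan_block_zero_pow using that by (intro eq_matI) auto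
  from dvd obtain h where "f - ?t = [:- x, 1:] ^ m * h" by (rule dvdE)
  then have f: "f = ?t + [:- x, 1:] ^ m * h" by (simp add: algebra_simps)
  have "poly_mat_eval h ?J \<in> carrier_mat k k" by simp
  then have "poly_mat_eval ([:- x, 1:] ^ m * h) ?J = 0\<^sub>m k k"
    using assms(1) left_mult_zero_mat[of "poly_mat_eval h ?J" k k k]
    by (simp add: poly_mat_eval_mult[OF J] poly_mat_eval_power[OF J] lin nil
        del: left_mult_zero_mat)
  then have eval: "poly_mat_eval f ?J = poly_mat_eval ?t ?J"
    unfolding f by (simp add: poly_mat_eval_add[OF J])
  show ?thesis
  proof (rule eq_matI)
    fix r s assume "r < dim_row (poly_mat_eval f ?J)" "s < dim_col (poly_mat_eval f ?J)"
    then have rs: "r < k" "s < k" using poly_mat_eval_dim[OF J, of f] by auto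
    have "jordan_block_cpow L k x z $$ (r, s) = (\<Sum>i\<in>{0..k}. ?a i * (?N ^\<^sub>m i) $$ (r, s))"
      unfolding jordan_block_cpow_def using rs
      by (subst index_finsum_mat) simp_all
    \<comment> \<open>Both truncations, at \<open>k\<close> inclusive and at \<open>m\<close> exclusive, have the same nonzero terms.\<close>
    also have "\<dots> = (\<Sum>i<k. ?a i * (?N ^\<^sub>m i) $$ (r, s))"
      using rs by (intro sum.mono_neutral_right) (auto simp: nil)
    also have "\<dots> = (\<Sum>i<m. ?a i * (?N ^\<^sub>m i) $$ (r, s))"
      using rs assms(1) by (intro sum.mono_neutral_left) (auto simp: nil)
    also have "\<dots> = poly_mat_eval ?t ?J $$ (r, s)"
      using rs by (simp add: index_poly_mat_eval_sum[OF J] poly_mat_eval_smult[OF J]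
          poly_mat_eval_power[OF J] lin)
    finally show "jordan_block_cpow L k x z $$ (r, s) = poly_mat_eval f ?J $$ (r, s)"
      by (simp add: eval)
  next
    have "jordan_block_cpow L k x z \<in> carrier_mat k k"
      unfolding jordan_block_cpow_def by (intro finsum_mat_closed) simp
    then show "dim_row (jordan_block_cpow L k x z) = dim_row (poly_mat_eval f ?J)"
      "dim_col (jordan_block_cpow L k x z) = dim_col (poly_mat_eval f ?J)"
      by (simp_all add: poly_mat_eval_dim[OF J])
  qed
qed

text \<open>
  A single polynomial serves all Jordan matrices built from a finite stock \<open>X\<close> of blocks. This
  uniformity is what allows the comparison of two Jordan forms of one matrix, and of the Jordan
  forms of two matrices.
\<close>

lemma cpow_polynomial_exists:
  assumes "finite X"
  shows "\<exists>f. \<forall>n_as. set n_as \<subseteq> X \<longrightarrow>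
    jordan_matrix_cpow L n_as z = poly_mat_eval f (jordan_matrix n_as)"
proof -
  define m where "m = Max (insert 0 (fst ` X))"
  have m: "k \<le> m" if "(k, x) \<in> X" for k x
    unfolding m_def using assms that by (intro Max_ge) force+
  let ?t = "\<lambda>x. \<Sum>i<m. Polynomial.smult ((z gchoose i) * cpow L x (z - of_nat i)) ([:- x, 1:] ^ i)"
  obtain f where f: "\<forall>x \<in> snd ` X. [:- x, 1:] ^ m dvd f - ?t x"
    using simultaneous_congruences_linear_powers[of "snd ` X" m ?t] assms by blast
  have block: "jordan_block_cpow L k x z = poly_mat_eval f (jordan_block k x)"
    if "(k, x) \<in> X" for k x
    using that f by (intro jordan_block_cpow_eq_poly_mat_eval[OF m[OF that]]) force
  have "jordan_matrix_cpow L n_as z = poly_mat_eval f (jordan_matrix n_as)"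
    if "set n_as \<subseteq> X" for n_as
  proof -
    have "poly_mat_eval f (jordan_matrix n_as) =
        diag_block_mat (map (poly_mat_eval f) (map (\<lambda>(k, x). jordan_block k x) n_as))"
      unfolding jordan_matrix_def by (rule poly_mat_eval_diag_block_mat) auto
    also have "map (poly_mat_eval f) (map (\<lambda>(k, x). jordan_block k x) n_as) =
        map (\<lambda>(k, x). jordan_block_cpow L k x z) n_as"
      using that block by auto
    finally show ?thesis unfolding jordan_matrix_cpow_def ..
  qed
  then show ?thesis by blast
qed

text \<open>
  The power is independent of the Jordan decomposition: if \<open>f\<close> interpolates on the blocks of two
  decompositions, then both candidates for the power are equal to \<open>f(A)\<close>.
\<close>

lemma mat_cpow_eq:
  assumes A: "A \<in> carrier_mat n n" and nz: "0 \<notin> fst ` set n_as"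
    and sim: "similar_mat_wit A (jordan_matrix n_as) M M'"
  shows "mat_cpow L A z = M * jordan_matrix_cpow L n_as z * M'"
  unfolding mat_cpow_def
proof (rule the_equality)
  show "\<exists>bs P P'. 0 \<notin> fst ` set bs \<and> similar_mat_wit A (jordan_matrix bs) P P' \<and>
      M * jordan_matrix_cpow L n_as z * M' = P * jordan_matrix_cpow L bs z * P'"
    by (intro exI[of _ n_as] exI[of _ M] exI[of _ M'] conjI nz sim refl)
next
  fix B assume "\<exists>bs P P'. 0 \<notin> fst ` set bs \<and> similar_mat_wit A (jordan_matrix bs) P P' \<and>
    B = P * jordan_matrix_cpow L bs z * P'"
  then obtain bs P P' where sim': "similar_mat_wit A (jordan_matrix bs) P P'"
    and B: "B = P * jordan_matrix_cpow L bs z * P'" by (elim exE conjE)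
  obtain f where f: "\<forall>cs. set cs \<subseteq> set n_as \<union> set bs \<longrightarrow>
      jordan_matrix_cpow L cs z = poly_mat_eval f (jordan_matrix cs)"
    using cpow_polynomial_exists[of "set n_as \<union> set bs" L z] finite_Un finite_set by blast
  have "B = P * poly_mat_eval f (jordan_matrix bs) * P'"
    unfolding B using f[rule_format, of bs] by simp
  also have "\<dots> = poly_mat_eval f A" by (rule poly_mat_eval_similar[OF A sim', symmetric])
  also have "\<dots> = M * poly_mat_eval f (jordan_matrix n_as) * M'"
    by (rule poly_mat_eval_similar[OF A sim])
  also have "\<dots> = M * jordan_matrix_cpow L n_as z * M'"
    using f[rule_format, of n_as] by simp
  finally show "B = M * jordan_matrix_cpow L n_as z * M'" .
qed

lemma complex_jordan_decomposition:
  fixes A :: "complex mat"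
  assumes A: "A \<in> carrier_mat n n"
  obtains n_as M M' where "0 \<notin> fst ` set n_as" "similar_mat_wit A (jordan_matrix n_as) M M'"
proof -
  obtain as where "char_poly A = (\<Prod>a\<leftarrow>as. [:- a, 1:])"
    using char_poly_factorized[OF A] by (elim exE conjE)
  from jordan_nf_exists[OF A this] obtain n_as where "jordan_nf A n_as" ..
  then show thesis using that unfolding jordan_nf_def similar_mat_def by (elim exE conjE)
qed

lemma mat_cpow_common_polynomial:
  assumes A: "A \<in> carrier_mat n n" and B: "B \<in> carrier_mat p p"
  obtains f where "mat_cpow L A z = poly_mat_eval f A" "mat_cpow L B z = poly_mat_eval f B"
proof -
  obtain as M M' where a: "0 \<notin> fst ` set as" "similar_mat_wit A (jordan_matrix as) M M'"
    by (rule complex_jordan_decomposition[OF A])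
  obtain bs P P' where b: "0 \<notin> fst ` set bs" "similar_mat_wit B (jordan_matrix bs) P P'"
    by (rule complex_jordan_decomposition[OF B])
  obtain f where f: "\<forall>cs. set cs \<subseteq> set as \<union> set bs \<longrightarrow>
      jordan_matrix_cpow L cs z = poly_mat_eval f (jordan_matrix cs)"
    using cpow_polynomial_exists[of "set as \<union> set bs" L z] finite_Un finite_set by blast
  have "mat_cpow L A z = poly_mat_eval f A"
    unfolding mat_cpow_eq[OF A a] poly_mat_eval_similar[OF A a(2)]
    using f[rule_format, of as] by simp
  moreover have "mat_cpow L B z = poly_mat_eval f B"
    unfolding mat_cpow_eq[OF B b] poly_mat_eval_similar[OF B b(2)]
    using f[rule_format, of bs] by simp
  ultimately show thesis by (rule that)
qed

section \<open>Companion matrices and inverse powers\<close>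

lemma index_mult_poly_mat_eval:
  assumes A: "A \<in> carrier_mat n n" and X: "X \<in> carrier_mat n n"
    and "r < n" "s < n" and N: "degree f \<le> N"
  shows "(X * poly_mat_eval f A) $$ (r, s) = (\<Sum>k\<le>N. coeff f k * (X * A ^\<^sub>m k) $$ (r, s))"
proof -
  have P: "A ^\<^sub>m k \<in> carrier_mat n n" for k using A by simp
  have "(X * poly_mat_eval f A) $$ (r, s) =
      (\<Sum>l<n. X $$ (r, l) * (\<Sum>k\<le>N. coeff f k * (A ^\<^sub>m k) $$ (l, s)))"
    using assms
    by (simp add: index_mult_mat_sum[OF X poly_mat_eval_carrier[OF A]]
        index_poly_mat_eval[OF A _ _ N] del: index_mult_mat)
  also have "\<dots> = (\<Sum>k\<le>N. \<Sum>l<n. X $$ (r, l) * (coeff f k * (A ^\<^sub>m k) $$ (l, s)))"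
    unfolding sum_distrib_left by (rule sum.swap)
  also have "\<dots> = (\<Sum>k\<le>N. coeff f k * (X * A ^\<^sub>m k) $$ (r, s))"
  proof (rule sum.cong)
    fix k
    have "(X * A ^\<^sub>m k) $$ (r, s) = (\<Sum>l<n. X $$ (r, l) * (A ^\<^sub>m k) $$ (l, s))"
      by (rule index_mult_mat_sum[OF X P assms(3,4)])
    then show "(\<Sum>l<n. X $$ (r, l) * (coeff f k * (A ^\<^sub>m k) $$ (l, s))) =
        coeff f k * (X * A ^\<^sub>m k) $$ (r, s)"
      by (simp add: sum_distrib_left mult.left_commute)
  qed simp
  finally show ?thesis .
qed

lemma inverse_power_cancel:
  fixes A :: "'a :: semiring_1 mat"
  assumes A: "A \<in> carrier_mat n n" and B: "B \<in> carrier_mat n n" and BA: "B * A = 1\<^sub>m n"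
  shows "B ^\<^sub>m (j + k) * A ^\<^sub>m k = B ^\<^sub>m j"
proof (induction k)
  case 0
  show ?case using A B right_mult_one_mat[of "B ^\<^sub>m j" n n] by simp
next
  case (Suc k)
  let ?X = "B ^\<^sub>m (j + k)" and ?Y = "A ^\<^sub>m k"
  have c: "?X \<in> carrier_mat n n" "?Y \<in> carrier_mat n n" using A B by simp_all
  note assoc = assoc_mult_mat[of _ n n _ n _ n]
  have "B ^\<^sub>m (j + Suc k) * A ^\<^sub>m Suc k = (?X * B) * (A * ?Y)"
    unfolding pow_mat_Suc_left[OF A] by simp
  also have "\<dots> = ?X * (B * (A * ?Y))"
    by (rule assoc[OF c(1) B mult_carrier_mat[OF A c(2)]])
  also have "B * (A * ?Y) = (B * A) * ?Y" by (rule assoc[OF B A c(2), symmetric])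
  also have "\<dots> = ?Y" unfolding BA by (rule left_mult_one_mat[OF c(2)])
  finally show ?case using Suc by simp
qed

lemma coeff_monic_poly:
  "coeff (monic_poly p c) k = (if k = p then 1 else if k < p then - c k else 0)"
  unfolding monic_poly_def by (simp add: coeff_sum)

lemma degree_monic_poly_le: "degree (monic_poly p c) \<le> p"
  by (rule degree_le) (simp add: coeff_monic_poly)

lemma companion_mat_carrier: "companion_mat p c \<in> carrier_mat p p"
  unfolding companion_mat_def by simp

lemma coeff_vec_carrier: "coeff_vec p c \<in> carrier_vec p"
  unfolding coeff_vec_def by simp

lemma index_companion_mult_vec:
  assumes "v \<in> carrier_vec p" and "i < p"
  shows "(companion_mat p c *\<^sub>v v) $ i =
    c (p - 1 - i) * v $ 0 + (if Suc i < p then v $ Suc i else 0)"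
proof -
  obtain q where q: "p = Suc q" using assms(2) by (cases p) auto
  have "(companion_mat p c *\<^sub>v v) $ i =
      (\<Sum>j<p. (if j = 0 then c (p - 1 - i) else if j = Suc i then 1 else 0) * v $ j)"
    using assms unfolding companion_mat_def by (simp add: scalar_prod_def atLeast0LessThan)
  also have "\<dots> = c (p - 1 - i) * v $ 0 + (\<Sum>j<q. (if j = i then 1 else 0) * v $ Suc j)"
    unfolding q by (subst sum.lessThan_Suc_shift) simp
  also have "(\<Sum>j<q. (if j = i then 1 else 0) * v $ Suc j) =
      (\<Sum>j<q. if j = i then v $ Suc i else 0)"
    by (intro sum.cong) auto
  also have "(\<Sum>j<q. if j = i then v $ Suc i else 0) = (if Suc i < p then v $ Suc i else 0)"
    unfolding q by (simp add: sum.delta)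
  finally show ?thesis .
qed

text \<open>
  The linear map \<open>\<phi>(v) = v_1 B + \<dots> + v_p B^p\<close>, to be used with \<open>B\<close> inverse to \<open>A\<close>. Its index
  starts at 1, whereas vectors are indexed from 0.
\<close>

definition inverse_power_sum :: "nat \<Rightarrow> nat \<Rightarrow> complex mat \<Rightarrow> complex vec \<Rightarrow> complex mat" where
  "inverse_power_sum n p B v =
     (\<Oplus>\<^bsub>module_mat TYPE(complex) n n\<^esub> i\<in>{1..p}. v $ (i - 1) \<cdot>\<^sub>m (B ^\<^sub>m i))"

lemma inverse_power_sum_carrier:
  "B \<in> carrier_mat n n \<Longrightarrow> inverse_power_sum n p B v \<in> carrier_mat n n"
  unfolding inverse_power_sum_def by (intro finsum_mat_closed) simp

lemma inverse_power_sum_dim [simp]: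
  assumes "B \<in> carrier_mat n n"
  shows "dim_row (inverse_power_sum n p B v) = n" "dim_col (inverse_power_sum n p B v) = n"
  using inverse_power_sum_carrier[OF assms, of p v] by auto

lemma index_inverse_power_sum:
  assumes B: "B \<in> carrier_mat n n" and rs: "r < n" "s < n"
  shows "inverse_power_sum n p B v $$ (r, s) = (\<Sum>i<p. v $ i * (B ^\<^sub>m Suc i) $$ (r, s))"
proof -
  have "inverse_power_sum n p B v $$ (r, s) =
      (\<Sum>i\<in>{1..p}. (v $ (i - 1) \<cdot>\<^sub>m B ^\<^sub>m i) $$ (r, s))"
    unfolding inverse_power_sum_def by (rule index_finsum_mat) (simp_all add: B rs)
  also have "\<dots> = (\<Sum>i\<in>{1..p}. v $ (i - 1) * (B ^\<^sub>m i) $$ (r, s))"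
    using B rs by (intro sum.cong refl index_smult_mat(1)) simp_all
  also have "\<dots> = (\<Sum>i<p. v $ i * (B ^\<^sub>m Suc i) $$ (r, s))"
    by (rule sum.reindex_bij_witness[of _ Suc "\<lambda>i. i - 1"]) auto
  finally show ?thesis .
qed

text \<open>
  This is \<open>A^(-p) Q(A) = 0\<close>, solved for its leading term \<open>A^(-p) A^p = I\<close>.
\<close>

lemma inverse_power_sum_coeff_vec:
  assumes A: "A \<in> carrier_mat n n" and B: "B \<in> carrier_mat n n" and BA: "B * A = 1\<^sub>m n"
    and Q: "poly_mat_eval (monic_poly p c) A = 0\<^sub>m n n"
  shows "inverse_power_sum n p B (coeff_vec p c) = 1\<^sub>m n"
proof (rule eq_matI)
  fix r s assume "r < dim_row (1\<^sub>m n :: complex mat)" "s < dim_col (1\<^sub>m n :: complex mat)"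
  then have rs: "r < n" "s < n" by auto
  have Bp: "B ^\<^sub>m p \<in> carrier_mat n n" using B by simp
  have cancel: "B ^\<^sub>m p * A ^\<^sub>m k = B ^\<^sub>m (p - k)" if "k \<le> p" for k
    using inverse_power_cancel[OF A B BA, of "p - k" k] that by simp
  have "0 = (B ^\<^sub>m p * poly_mat_eval (monic_poly p c) A) $$ (r, s)"
    unfolding Q using right_mult_zero_mat[OF Bp, of n] rs by simp
  also have "\<dots> = (\<Sum>k\<le>p. coeff (monic_poly p c) k * (B ^\<^sub>m p * A ^\<^sub>m k) $$ (r, s))"
    by (rule index_mult_poly_mat_eval[OF A Bp rs degree_monic_poly_le])
  also have "\<dots> = (\<Sum>k\<le>p. coeff (monic_poly p c) k * (B ^\<^sub>m (p - k)) $$ (r, s))"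
    by (intro sum.cong) (simp_all add: cancel)
  also have "\<dots> = (\<Sum>k<p. - c k * (B ^\<^sub>m (p - k)) $$ (r, s)) + 1\<^sub>m n $$ (r, s)"
    using B by (simp add: lessThan_Suc_atMost[symmetric] coeff_monic_poly)
  finally have "1\<^sub>m n $$ (r, s) = (\<Sum>k<p. c k * (B ^\<^sub>m (p - k)) $$ (r, s))"
    by (simp add: sum_negf)
  also have "\<dots> = (\<Sum>i<p. c (p - Suc i) * (B ^\<^sub>m (p - (p - Suc i))) $$ (r, s))"
    by (rule sum.nat_diff_reindex[symmetric])
  also have "\<dots> = (\<Sum>i<p. coeff_vec p c $ i * (B ^\<^sub>m Suc i) $$ (r, s))"
    by (intro sum.cong) (auto simp: coeff_vec_def Suc_diff_Suc)
  also have "\<dots> = inverse_power_sum n p B (coeff_vec p c) $$ (r, s)"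
    by (rule index_inverse_power_sum[OF B rs, symmetric])
  finally show "inverse_power_sum n p B (coeff_vec p c) $$ (r, s) = 1\<^sub>m n $$ (r, s)" ..
qed (simp_all add: B)

text \<open>
  Coordinate \<open>i\<close> of \<open>C v\<close> is \<open>v_1\<close> times the same coordinate of \<open>c\<close>, plus the next coordinate
  of \<open>v\<close>. The first part contributes \<open>v_1 \<phi>(c) = v_1 I\<close>, the second one the terms
  \<open>v_(i+1) A^(-i)\<close>, and together they make up \<open>A \<phi>(v)\<close>.
\<close>

lemma inverse_power_sum_companion_mult:
  assumes A: "A \<in> carrier_mat n n" and B: "B \<in> carrier_mat n n" and AB: "A * B = 1\<^sub>m n"
    and one: "inverse_power_sum n p B (coeff_vec p c) = 1\<^sub>m n"
    and p: "p \<ge> 1" and v: "v \<in> carrier_vec p"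
  shows "inverse_power_sum n p B (companion_mat p c *\<^sub>v v) = A * inverse_power_sum n p B v"
proof (rule eq_matI)
  fix r s
  assume "r < dim_row (A * inverse_power_sum n p B v)" "s < dim_col (A * inverse_power_sum n p B v)"
  then have rs: "r < n" "s < n" using A B by auto
  obtain q where q: "p = Suc q" using p by (cases p) auto
  have c: "B ^\<^sub>m i \<in> carrier_mat n n" for i using B by simp
  have cancel: "A * B ^\<^sub>m Suc i = B ^\<^sub>m i" for i
    unfolding pow_mat_Suc_left[OF B]
    unfolding assoc_mult_mat[OF A B c, symmetric] AB by (rule left_mult_one_mat[OF c])
  have "inverse_power_sum n p B (companion_mat p c *\<^sub>v v) $$ (r, s) =
      (\<Sum>i<p. (c (p - 1 - i) * v $ 0 + (if Suc i < p then v $ Suc i else 0)) *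
        (B ^\<^sub>m Suc i) $$ (r, s))"
    unfolding index_inverse_power_sum[OF B rs]
    by (intro sum.cong) (simp_all add: index_companion_mult_vec[OF v] del: pow_mat.simps)
  also have "\<dots> = v $ 0 * (\<Sum>i<p. coeff_vec p c $ i * (B ^\<^sub>m Suc i) $$ (r, s)) +
      (\<Sum>i<p. (if Suc i < p then v $ Suc i else 0) * (B ^\<^sub>m Suc i) $$ (r, s))"
    unfolding sum_distrib_left sum.distrib[symmetric]
    by (intro sum.cong) (simp_all add: coeff_vec_def algebra_simps del: pow_mat.simps)
  also have "(\<Sum>i<p. coeff_vec p c $ i * (B ^\<^sub>m Suc i) $$ (r, s)) = (B ^\<^sub>m 0) $$ (r, s)"
    unfolding index_inverse_power_sum[OF B rs, symmetric] one using B by simp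
  also have "(\<Sum>i<p. (if Suc i < p then v $ Suc i else 0) * (B ^\<^sub>m Suc i) $$ (r, s)) =
      (\<Sum>i<q. v $ Suc i * (B ^\<^sub>m Suc i) $$ (r, s))"
    unfolding q by (simp del: pow_mat.simps)
  also have "v $ 0 * (B ^\<^sub>m 0) $$ (r, s) + (\<Sum>i<q. v $ Suc i * (B ^\<^sub>m Suc i) $$ (r, s)) =
      (\<Sum>i<p. v $ i * (B ^\<^sub>m i) $$ (r, s))"
    unfolding q by (rule sum.lessThan_Suc_shift[symmetric])
  also have "\<dots> = (\<Sum>i<p. v $ i * (A * B ^\<^sub>m Suc i) $$ (r, s))"
    unfolding cancel ..
  also have "\<dots> = (\<Sum>i<p. \<Sum>l<n. A $$ (r, l) * (v $ i * (B ^\<^sub>m Suc i) $$ (l, s)))"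
  proof (rule sum.cong)
    fix i
    have "(A * B ^\<^sub>m Suc i) $$ (r, s) = (\<Sum>l<n. A $$ (r, l) * (B ^\<^sub>m Suc i) $$ (l, s))"
      by (rule index_mult_mat_sum[OF A c rs])
    then show "v $ i * (A * B ^\<^sub>m Suc i) $$ (r, s) =
        (\<Sum>l<n. A $$ (r, l) * (v $ i * (B ^\<^sub>m Suc i) $$ (l, s)))"
      by (simp add: sum_distrib_left mult.left_commute del: pow_mat.simps)
  qed simp
  also have "\<dots> = (\<Sum>l<n. A $$ (r, l) * inverse_power_sum n p B v $$ (l, s))"
    by (subst sum.swap)
      (simp add: sum_distrib_left index_inverse_power_sum[OF B _ rs(2)] del: pow_mat.simps)
  also have "\<dots> = (A * inverse_power_sum n p B v) $$ (r, s)"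
    by (rule index_mult_mat_sum[OF A inverse_power_sum_carrier[OF B] rs, symmetric])
  finally show "inverse_power_sum n p B (companion_mat p c *\<^sub>v v) $$ (r, s) =
      (A * inverse_power_sum n p B v) $$ (r, s)" .
qed (use A B in simp_all)

text \<open>
  The map \<open>\<phi>\<close> intertwines \<open>C\<close> with multiplication by \<open>A\<close> and sends \<open>c\<close> to \<open>I\<close>, hence sends
  \<open>f(C) c\<close> to \<open>f(A)\<close>.
\<close>

lemma inverse_power_sum_poly_companion:
  assumes A: "A \<in> carrier_mat n n" and B: "B \<in> carrier_mat n n"
    and AB: "A * B = 1\<^sub>m n" and BA: "B * A = 1\<^sub>m n" and p: "p \<ge> 1"
    and Q: "poly_mat_eval (monic_poly p c) A = 0\<^sub>m n n"
  shows "inverse_power_sum n p B (poly_mat_eval f (companion_mat p c) *\<^sub>v coeff_vec p c) =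
    poly_mat_eval f A"
proof (induction f)
  note C = companion_mat_carrier[of p c] and c = coeff_vec_carrier[of p c]
  case 0
  show ?case unfolding poly_mat_eval_0[OF A] poly_mat_eval_0[OF C]
    by (rule eq_matI) (use B c in \<open>auto simp: index_inverse_power_sum\<close>)
next
  note C = companion_mat_carrier[of p c] and c = coeff_vec_carrier[of p c]
  note one = inverse_power_sum_coeff_vec[OF A B BA Q]
  case (pCons a f)
  let ?C = "companion_mat p c" and ?c = "coeff_vec p c"
  let ?w = "poly_mat_eval f ?C *\<^sub>v ?c"
  have F: "poly_mat_eval f ?C \<in> carrier_mat p p" using C by simp
  have w: "?w \<in> carrier_vec p" using F c by simp
  have Cw: "?C *\<^sub>v ?w \<in> carrier_vec p" using C w by simp
  have "poly_mat_eval (pCons a f) ?C *\<^sub>v ?c = (a \<cdot>\<^sub>m 1\<^sub>m p) *\<^sub>v ?c + (?C * poly_mat_eval f ?C) *\<^sub>v ?c"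
    unfolding poly_mat_eval_pCons[OF C] using C F c
    by (intro add_mult_distrib_mat_vec[of _ p p]) simp_all
  also have "(?C * poly_mat_eval f ?C) *\<^sub>v ?c = ?C *\<^sub>v ?w"
    by (rule assoc_mult_mat_vec[OF C F c])
  also have "(a \<cdot>\<^sub>m 1\<^sub>m p) *\<^sub>v ?c = a \<cdot>\<^sub>v ?c"
    using c by (intro eq_vecI) auto
  finally have "inverse_power_sum n p B (poly_mat_eval (pCons a f) ?C *\<^sub>v ?c) =
      inverse_power_sum n p B (a \<cdot>\<^sub>v ?c + ?C *\<^sub>v ?w)" by simp
  also have "\<dots> = a \<cdot>\<^sub>m inverse_power_sum n p B ?c + inverse_power_sum n p B (?C *\<^sub>v ?w)"
  proof (rule eq_matI)
    fix r s
    assume "r < dim_row (a \<cdot>\<^sub>m inverse_power_sum n p B ?c + inverse_power_sum n p B (?C *\<^sub>v ?w))"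
      "s < dim_col (a \<cdot>\<^sub>m inverse_power_sum n p B ?c + inverse_power_sum n p B (?C *\<^sub>v ?w))"
    then have rs: "r < n" "s < n" using B by auto
    have "(a \<cdot>\<^sub>v ?c + ?C *\<^sub>v ?w) $ i = a * ?c $ i + (?C *\<^sub>v ?w) $ i" if "i < p" for i
      using that c Cw carrier_vecD[OF Cw] by (simp del: index_mult_mat_vec)
    then show "inverse_power_sum n p B (a \<cdot>\<^sub>v ?c + ?C *\<^sub>v ?w) $$ (r, s) =
        (a \<cdot>\<^sub>m inverse_power_sum n p B ?c + inverse_power_sum n p B (?C *\<^sub>v ?w)) $$ (r, s)"
      using B rs
      by (simp add: index_inverse_power_sum[OF B rs] sum.distrib sum_distrib_left distrib_right
          mult.assoc del: pow_mat.simps index_mult_mat_vec)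
  qed (use B in simp_all)
  also have "\<dots> = poly_mat_eval (pCons a f) A"
    unfolding one inverse_power_sum_companion_mult[OF A B AB one p w] pCons.IH
      poly_mat_eval_pCons[OF A] ..
  finally show ?case .
qed

lemma the_mat_inverse:
  fixes A :: "'a :: field mat"
  assumes A: "A \<in> carrier_mat n n" and "invertible_mat A"
  shows "the (mat_inverse A) \<in> carrier_mat n n"
    and "A * the (mat_inverse A) = 1\<^sub>m n" and "the (mat_inverse A) * A = 1\<^sub>m n"
proof -
  obtain B where B: "A * B = 1\<^sub>m n" "B * A = 1\<^sub>m (dim_row B)"
    using assms unfolding invertible_mat_def inverts_mat_def by auto
  have "dim_col B = n" using arg_cong[OF B(1), of dim_col] by simp
  moreover have "dim_row B = n" using arg_cong[OF B(2), of dim_col] A by simp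
  ultimately have "B \<in> carrier_mat n n" "B * A = 1\<^sub>m n" using B(2) by auto
  then have "A \<in> Units (ring_mat TYPE('a) n n)"
    using A B(1) unfolding Units_def ring_mat_def by auto
  then obtain B' where "mat_inverse A = Some B'"
    using mat_inverse(1)[OF A, of n] by (cases "mat_inverse A") auto
  then show "the (mat_inverse A) \<in> carrier_mat n n"
    "A * the (mat_inverse A) = 1\<^sub>m n" "the (mat_inverse A) * A = 1\<^sub>m n"
    using mat_inverse(2)[OF A] by auto
qed

theorem theorem2p1:
  fixes L :: "complex \<Rightarrow> complex" and n p :: nat
    and A :: "complex mat" and c :: "nat \<Rightarrow> complex"
  assumes "log_choice L"
    and "n \<ge> 1" and "p \<ge> 1"
    and "A \<in> carrier_mat n n" and "invertible_mat A"
    and "c 0 \<noteq> 0"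
    and "poly_mat_eval (monic_poly p c) A = 0\<^sub>m n n"
  shows "\<forall>z. mat_cpow L A z =
    (\<Oplus>\<^bsub>module_mat TYPE(complex) n n\<^esub> i\<in>{1..p}.
       companion_coord L p c i z \<cdot>\<^sub>m (the (mat_inverse A) ^\<^sub>m i))"
proof
  fix z
  let ?C = "companion_mat p c" and ?B = "the (mat_inverse A)"
  note B = the_mat_inverse[OF assms(4,5)]
  obtain f where fA: "mat_cpow L A z = poly_mat_eval f A"
    and fC: "mat_cpow L ?C z = poly_mat_eval f ?C"
    by (rule mat_cpow_common_polynomial[OF assms(4) companion_mat_carrier])
  have "mat_cpow L A z =
      inverse_power_sum n p ?B (poly_mat_eval f ?C *\<^sub>v coeff_vec p c)"
    unfolding fA by (rule inverse_power_sum_poly_companion[OF assms(4) B assms(3,7), symmetric])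
  then show "mat_cpow L A z = (\<Oplus>\<^bsub>module_mat TYPE(complex) n n\<^esub> i\<in>{1..p}.
      companion_coord L p c i z \<cdot>\<^sub>m (?B ^\<^sub>m i))"
    unfolding inverse_power_sum_def companion_coord_def fC .
qed

end
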